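(* Over $\mathbb{F}_7^2$ let $e=(1,0)$, $f=(0,1)$, $g=(6,6)$, and let $Q_0=e\,f^{6}\,g^{12}$ be the multiset of length $19$ consisting of one copy of $e$, six copies of $f$ and twelve copies of $g$. Then: (1) every line $L$ contains at most $12$ elements of $Q_0$, counted with multiplicity; (2) the only zero-sum sub-multiset of $Q_0$ of size $7$ or $14$ is $g^7$, which is collinear and satisfies $|\Omega(g^7)|=1$; (3) the sub-multiset $e\,f\,g^{8}$ of $Q_0$, of size $10$, is zero-sum, spans $\mathbb{F}_7^2$, and satisfies $\Omega(e\,f\,g^8)=\mathbb{F}_7$; consequently $\sigma(Q_0)\ge 6$.
   Context: A line is a $1$-dimensional $\mathbb{F}_7$-linear subspace of $\mathbb{F}_7^2$; a multiset over $\mathbb{F}_7^2$ is collinear if all its elements lie on one line, and zero-sum if its elements sum to $(0,0)$. Sizes and lengths of multisets count multiplicity. For a finite multiset $B=\{q_1,\dots,q_k\}$ over $\mathbb{F}_7^2$ with $q_i=(a_i,b_i)$, the cross-sum set is $$\Omega(B)=\Big\{\sum_{1\le s<t\le k}a_{\tau(s)}b_{\tau(t)}\;:\;\tau\in S_k\Big\}\subseteq\mathbb{F}_7 .$$ The spread of a multiset $Q$ over $\mathbb{F}_7^2\setminus\{(0,0)\}$ is $\sigma(Q)=\max\sum_{j=1}^{t}(|\Omega(B_j)|-1)$, the maximum over all families of pairwise-disjoint nonempty zero-sum sub-multisets $B_1,\dots,B_t$ of $Q$ (disjoint meaning that the multiplicities used in total do not exceed those of $Q$). *)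

theory Defs
  imports
    "HOL-Analysis.Analysis"
    "HOL-Combinatorics.Permutations"
    "HOL-Library.Multiset"
    "Berlekamp_Zassenhaus.Finite_Field"
begin

text \<open>\<open>'a mod_ring\<close> is the ring of integers modulo \<open>CARD('a)\<close>, a field
  if the index type is in class \<^class>\<open>prime_card\<close>. The library numeral type \<open>7\<close> cannot be
  put into that class (it is an instance of a generic type constructor), hence an index
  type with seven elements of its own.\<close>

typedef seven = "{..<7::nat}"
  by (rule exI [of _ 0]) simp

lemma CARD_seven [simp]: "CARD(seven) = 7"
  by (simp add: type_definition.card [OF type_definition_seven])

instance seven :: prime_card
  by standard simp

type_synonym F7 = "seven mod_ring"

definition is_line :: "(F7 ^ 2) set \<Rightarrow> bool" where
  "is_line L \<longleftrightarrow> vec.subspace L \<and> vec.dim L = 1"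

definition collinear_mset :: "(F7 ^ 2) multiset \<Rightarrow> bool" where
  "collinear_mset B \<longleftrightarrow> (\<exists>L. is_line L \<and> set_mset B \<subseteq> L)"

definition zero_sum :: "(F7 ^ 2) multiset \<Rightarrow> bool" where
  "zero_sum B \<longleftrightarrow> \<Sum>\<^sub># B = 0"

text \<open>The list \<open>q\<close> is an enumeration of \<open>B\<close>, indexed from 0; the resulting set does not depend
  on the enumeration chosen, so ranging over all of them changes nothing.\<close>

definition cross_sum_set :: "(F7 ^ 2) multiset \<Rightarrow> F7 set" where
  "cross_sum_set B =
     {\<Sum>(s, t) \<in> {(s, t). s < t \<and> t < size B}. (q ! \<tau> s) $ 1 * (q ! \<tau> t) $ 2 | q \<tau>.
        mset q = B \<and> \<tau> permutes {..<size B}}"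

text \<open>A family of pairwise disjoint sub-multisets of \<open>Q\<close> is a multiset \<open>F\<close> of multisets whose
  total \<open>\<Sum>\<^sub># F\<close> is contained in \<open>Q\<close>. The empty family is admitted, so that the maximum is always
  over a nonempty set, and the spread is 0 if \<open>Q\<close> has no nonempty zero-sum sub-multiset.
  The natural subtraction never truncates, as cross-sum sets are nonempty.\<close>

definition zero_sum_family :: "(F7 ^ 2) multiset \<Rightarrow> (F7 ^ 2) multiset multiset \<Rightarrow> bool" where
  "zero_sum_family Q F \<longleftrightarrow> (\<forall>B \<in># F. B \<noteq> {#} \<and> zero_sum B) \<and> \<Sum>\<^sub># F \<subseteq># Q"

definition spread :: "(F7 ^ 2) multiset \<Rightarrow> nat" where
  "spread Q = Max {\<Sum>B \<in># F. card (cross_sum_set B) - 1 | F. zero_sum_family Q F}"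

text \<open>The set under the maximum is finite and nonempty, so \<^const>\<open>Max\<close> is the true maximum.\<close>

lemma cross_sum_set_nonempty: "cross_sum_set B \<noteq> {}"
proof -
  obtain q where "mset q = B"
    using ex_mset by blast
  then show ?thesis
    unfolding cross_sum_set_def using permutes_id by blast
qed

lemma spread_values_finite:
  "finite {\<Sum>B \<in># F. card (cross_sum_set B) - 1 | F. zero_sum_family Q F}"
proof -
  have "(\<Sum>B \<in># F. card (cross_sum_set B) - 1) \<le> 7 * size Q" if "zero_sum_family Q F" for F
  proof -
    have "card (cross_sum_set B) - 1 \<le> 7 * size B" if "B \<in># F" for B
    proof -
      have "B \<noteq> {#}"
        using \<open>zero_sum_family Q F\<close> that by (auto simp: zero_sum_family_def)
      then have "size B \<ge> 1"
        by (simp add: Suc_le_eq nonempty_has_size)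
      moreover have "card (cross_sum_set B) \<le> CARD(F7)"
        by (intro card_mono) auto
      ultimately show ?thesis
        by simp
    qed
    then have "(\<Sum>B \<in># F. card (cross_sum_set B) - 1) \<le> (\<Sum>B \<in># F. 7 * size B)"
      by (rule sum_mset_mono)
    also have "\<dots> = 7 * size (\<Sum>\<^sub># F)"
      by (induction F) auto
    also have "\<dots> \<le> 7 * size Q"
      using \<open>zero_sum_family Q F\<close> size_mset_mono [of "\<Sum>\<^sub># F" Q]
      unfolding zero_sum_family_def by linarith
    finally show ?thesis .
  qed
  then have "{\<Sum>B \<in># F. card (cross_sum_set B) - 1 | F. zero_sum_family Q F} \<subseteq> {..7 * size Q}"
    by auto
  then show ?thesis
    by (rule finite_subset) simp
qed

lemma spread_values_nonempty:
  "{\<Sum>B \<in># F. card (cross_sum_set B) - 1 | F. zero_sum_family Q F} \<noteq> {}"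
proof -
  have "zero_sum_family Q {#}"
    by (simp add: zero_sum_family_def)
  then show ?thesis
    by blast
qed

end

theory Submission
  imports Defs
begin

text \<open>Everything rests on \<open>e + f + g = 0\<close>, with \<open>e\<close> and \<open>f\<close> independent.

  Any two of \<open>e\<close>, \<open>f\<close>, \<open>g\<close> therefore span the plane, so a line contains at most one of them, and the
  largest multiplicity in \<open>Q\<^sub>0\<close>, namely 12, bounds its share. A sub-multiset
  \<open>e\<^sup>i f\<^sup>j g\<^sup>k\<close> is zero-sum iff \<open>i \<equiv> j \<equiv> k (mod 7)\<close>; with \<open>i \<le> 1\<close>, \<open>j \<le> 6\<close> and
  \<open>k \<le> 12\<close> this leaves \<open>i = j\<close>, and the lengths 0 and 7 for \<open>i = 0\<close>, 3 and 10 for \<open>i = 1\<close>.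
  Only \<open>g\<^sup>7\<close> has length 7 or 14, and having a single ordering it has a single cross sum.

  For \<open>e f g\<^sup>8\<close>, permuting an enumeration only produces another enumeration
  (\<open>cross_sum_set_eq\<close>), so that it suffices to exhibit orderings. The ordering
  \<open>e g\<^sup>b f g\<^bsup>8-b\<^esup>\<close> has cross sum \<open>-b\<close>: by \<open>cross_sum_append\<close> the pair \<open>e\<close>, \<open>f\<close> contributes 1, the
  pairs of \<open>e\<close> with a later \<open>g\<close> contribute \<open>-8\<close>, the pairs of \<open>f\<close> with an earlier \<open>g\<close> contribute
  \<open>-b\<close>, and the pairs of two copies of \<open>g\<close> contribute \<open>8 choose 2 = 28\<close>, which vanishes modulo 7.
  Letting \<open>b\<close> run through \<open>0, \<dots>, 6\<close> gives all of the field, and the family consisting of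
  \<open>e f g\<^sup>8\<close> alone witnesses a spread of at least \<open>7 - 1\<close>.\<close>

section \<open>Cross sums of lists\<close>

definition cross_sum :: "(F7 ^ 2) list \<Rightarrow> F7" where
  "cross_sum xs = (\<Sum>(s, t) \<in> {(s, t). s < t \<and> t < length xs}. xs ! s $ 1 * xs ! t $ 2)"

text \<open>The enumeration and the permutation can be merged into one list, which frees all later
  computations from permutations.\<close>

lemma cross_sum_set_eq: "cross_sum_set B = cross_sum ` {xs. mset xs = B}"
proof
  show "cross_sum_set B \<subseteq> cross_sum ` {xs. mset xs = B}"
  proof
    fix x assume "x \<in> cross_sum_set B"
    then obtain q \<tau> where q: "mset q = B" and \<tau>: "\<tau> permutes {..<size B}"
      and x: "x = (\<Sum>(s, t) \<in> {(s, t). s < t \<and> t < size B}. (q ! \<tau> s) $ 1 * (q ! \<tau> t) $ 2)"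
      unfolding cross_sum_set_def by blast
    have len: "size B = length q"
      using q by auto
    have "x = cross_sum (permute_list \<tau> q)"
      unfolding cross_sum_def x length_permute_list len
      by (rule sum.cong) (use \<tau> len in \<open>auto simp: permute_list_nth\<close>)
    moreover have "mset (permute_list \<tau> q) = B"
      using \<tau> q len by simp
    ultimately show "x \<in> cross_sum ` {xs. mset xs = B}"
      by blast
  qed
  show "cross_sum ` {xs. mset xs = B} \<subseteq> cross_sum_set B"
  proof clarify
    fix xs assume "B = mset xs"
    moreover have "(id :: nat \<Rightarrow> nat) permutes {..<size (mset xs)}"
      by (rule permutes_id)
    ultimately show "cross_sum xs \<in> cross_sum_set (mset xs)"
      unfolding cross_sum_set_def cross_sum_def
      by (intro CollectI exI [of _ xs] exI [of _ "id :: nat \<Rightarrow> nat"]) simp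
  qed
qed

lemma cross_sum_Nil: "cross_sum [] = 0"
  by (simp add: cross_sum_def)

lemma cross_sum_snoc:
  "cross_sum (xs @ [x]) = cross_sum xs + (\<Sum>y\<leftarrow>xs. y $ 1) * x $ 2"
proof -
  let ?n = "length xs"
  let ?old = "{(s, t). s < t \<and> t < ?n}"
  let ?new = "(\<lambda>s. (s, ?n)) ` {..<?n}"
  let ?h = "\<lambda>(s, t). (xs @ [x]) ! s $ 1 * (xs @ [x]) ! t $ 2"
  have split: "{(s, t). s < t \<and> t < length (xs @ [x])} = ?old \<union> ?new"
    by (auto simp: less_Suc_eq)
  have "finite ?old"
    by (rule finite_subset [of _ "{..<?n} \<times> {..<?n}"]) auto
  then have "cross_sum (xs @ [x]) = sum ?h ?old + sum ?h ?new"
    unfolding cross_sum_def split by (intro sum.union_disjoint) auto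
  also have "sum ?h ?old = cross_sum xs"
    unfolding cross_sum_def by (rule sum.cong) (auto simp: nth_append)
  also have "sum ?h ?new = (\<Sum>s<?n. xs ! s $ 1 * x $ 2)"
    by (subst sum.reindex) (auto simp: inj_on_def nth_append)
  also have "\<dots> = (\<Sum>y\<leftarrow>xs. y $ 1) * x $ 2"
    by (simp add: sum_distrib_right sum_list_sum_nth atLeast0LessThan)
  finally show ?thesis .
qed

text \<open>A pair of positions lies within \<open>xs\<close>, within \<open>ys\<close>, or starts in \<open>xs\<close> and ends in \<open>ys\<close>; the
  pairs of the last kind form a full rectangle, hence the product. Cross sums of words made of
  constant blocks reduce to those of the blocks in this way.\<close>

lemma cross_sum_append:
  "cross_sum (xs @ ys) =
     cross_sum xs + cross_sum ys + (\<Sum>x\<leftarrow>xs. x $ 1) * (\<Sum>y\<leftarrow>ys. y $ 2)"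
proof (induction ys rule: rev_induct)
  case Nil
  show ?case by (simp add: cross_sum_Nil)
next
  case (snoc y ys)
  have "cross_sum (xs @ ys @ [y]) = cross_sum ((xs @ ys) @ [y])"
    by simp
  then show ?case
    unfolding cross_sum_snoc snoc.IH by (simp add: algebra_simps)
qed

lemma cross_sum_singleton: "cross_sum [x] = 0"
  using cross_sum_snoc [of "[]" x] by (simp add: cross_sum_Nil)

lemma cross_sum_replicate:
  "cross_sum (replicate n x) = of_nat (n choose 2) * (x $ 1 * x $ 2)"
proof (induction n)
  case 0
  show ?case by (simp add: cross_sum_Nil numeral_2_eq_2)
next
  case (Suc n)
  have "cross_sum (replicate (Suc n) x) = cross_sum (replicate n x @ [x])"
    by (simp add: replicate_append_same)
  then show ?case
    unfolding cross_sum_snoc Suc.IH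
    by (simp add: numeral_2_eq_2 sum_list_replicate algebra_simps)
qed

section \<open>Arithmetic in the plane over the field with seven elements\<close>

lemma F7_of_nat_eq_0_iff: "of_nat n = (0 :: F7) \<longleftrightarrow> 7 dvd n"
  by (simp add: of_nat_eq_0_iff_char_dvd)

lemma F7_seven: "(7 :: F7) = 0"
  using F7_of_nat_eq_0_iff [of 7] by simp

lemma F7_six: "(6 :: F7) = -1"
proof -
  have "(6 :: F7) + 1 = 7"
    by simp
  then show ?thesis
    unfolding F7_seven by (simp add: eq_neg_iff_add_eq_0)
qed

lemma size_filter_replicate_mset:
  "size {#y \<in># replicate_mset n x. P y#} = (if P x then n else 0)"
  by (induction n) auto

lemma span_standard_basis:
  fixes e f :: "F7 ^ 2"
  assumes e: "e = vector [1, 0]" and f: "f = vector [0, 1]"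
  shows "vec.span {e, f} = UNIV"
proof -
  have "v \<in> vec.span {e, f}" for v
  proof -
    have "v = v $ 1 *s e + v $ 2 *s f"
      by (simp add: vec_eq_iff forall_2 e f)
    also have "\<dots> \<in> vec.span {e, f}"
      by (intro vec.span_add vec.span_scale vec.span_base) auto
    finally show ?thesis .
  qed
  then show ?thesis
    by blast
qed

section \<open>The multiset with one e, six f and twelve g\<close>

theorem mainTheorem4:
  fixes e f g :: "F7 ^ 2" and Q\<^sub>0 :: "(F7 ^ 2) multiset"
  assumes e: "e = vector [1, 0]"
    and f: "f = vector [0, 1]"
    and g: "g = vector [6, 6]"
    and Q\<^sub>0: "Q\<^sub>0 = {#e#} + replicate_mset 6 f + replicate_mset 12 g"
  shows "size Q\<^sub>0 = 19 \<and>
    (\<forall>L. is_line L \<longrightarrow> size {#q \<in># Q\<^sub>0. q \<in> L#} \<le> 12) \<and>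
    ({B. B \<subseteq># Q\<^sub>0 \<and> zero_sum B \<and> (size B = 7 \<or> size B = 14)} = {replicate_mset 7 g} \<and>
     collinear_mset (replicate_mset 7 g) \<and>
     card (cross_sum_set (replicate_mset 7 g)) = 1) \<and>
    ({#e, f#} + replicate_mset 8 g \<subseteq># Q\<^sub>0 \<and>
     size ({#e, f#} + replicate_mset 8 g) = 10 \<and>
     zero_sum ({#e, f#} + replicate_mset 8 g) \<and>
     vec.span (set_mset ({#e, f#} + replicate_mset 8 g)) = UNIV \<and>
     cross_sum_set ({#e, f#} + replicate_mset 8 g) = UNIV \<and>
     spread Q\<^sub>0 \<ge> 6)"
proof -
  have g': "g = vector [-1, -1]"
    by (simp add: g F7_six)
  have distinct: "e \<noteq> f" "e \<noteq> g" "f \<noteq> g"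
    by (auto simp: vec_eq_iff forall_2 e f g')
  have g_neg: "g = - e - f"
    by (simp add: vec_eq_iff forall_2 e f g')
  have span: "vec.span {e, f} = UNIV"
    using e f by (rule span_standard_basis)
  define B where "B = {#e, f#} + replicate_mset 8 g"

  have lines: "size {#q \<in># Q\<^sub>0. q \<in> L#} \<le> 12" if L: "is_line L" for L
  proof -
    have sub: "vec.subspace L" and dim: "vec.dim L = 1"
      using L by (auto simp: is_line_def)
    have ef: "\<not> (e \<in> L \<and> f \<in> L)"
    proof
      assume "e \<in> L \<and> f \<in> L"
      then have "vec.span {e, f} \<subseteq> L"
        by (intro vec.span_minimal sub) auto
      then have "L = UNIV"
        using span by auto
      then show False
        using dim vec_dim_card [where 'a = F7 and 'n = 2] by simp
    qed
    have eg: "f \<in> L" if "e \<in> L" "g \<in> L"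
    proof -
      have "f = - e - g"
        by (simp add: g_neg)
      then show ?thesis
        using that vec.subspace_diff [OF sub] vec.subspace_neg [OF sub] by metis
    qed
    have fg: "e \<in> L" if "f \<in> L" "g \<in> L"
    proof -
      have "e = - f - g"
        by (simp add: g_neg)
      then show ?thesis
        using that vec.subspace_diff [OF sub] vec.subspace_neg [OF sub] by metis
    qed
    have "size {#q \<in># Q\<^sub>0. q \<in> L#} =
        (if e \<in> L then 1 else 0) + (if f \<in> L then 6 else 0) + (if g \<in> L then 12 else 0)"
      by (simp add: Q\<^sub>0 size_filter_replicate_mset)
    then show ?thesis
      using ef eg fg by auto
  qed

  have uniq: "C = replicate_mset 7 g"
    if C: "C \<subseteq># Q\<^sub>0" "zero_sum C" "size C = 7 \<or> size C = 14" for C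
  proof -
    define i j k where ijk: "i = count C e" "j = count C f" "k = count C g"
    have le: "count C x \<le> count Q\<^sub>0 x" for x
      using C(1) by (rule mset_subset_eq_count)
    have bounds: "i \<le> 1" "j \<le> 6" "k \<le> 12"
      using le [of e] le [of f] le [of g] distinct by (auto simp: ijk Q\<^sub>0)
    have C_eq: "C = replicate_mset i e + replicate_mset j f + replicate_mset k g"
    proof (rule multiset_eqI)
      fix x
      have "count C x = 0" if "x \<notin> {e, f, g}"
        using le [of x] that by (auto simp: Q\<^sub>0)
      then show "count C x = count (replicate_mset i e + replicate_mset j f + replicate_mset k g) x"
        using distinct by (cases "x \<in> {e, f, g}") (auto simp: ijk)
    qed
    have "(\<Sum>\<^sub># C) $ 1 = 0" "(\<Sum>\<^sub># C) $ 2 = 0"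
      using C(2) by (simp_all add: zero_sum_def)
    \<comment> \<open>The coefficient 6 stands for \<open>-1\<close>, so that everything stays in the naturals.\<close>
    then have "of_nat (i + 6 * k) = (0 :: F7)" "of_nat (j + 6 * k) = (0 :: F7)"
      unfolding C_eq by (simp_all add: of_nat_index e f g' F7_six)
    then have dvd: "7 dvd i + 6 * k" "7 dvd j + 6 * k"
      by (simp_all only: F7_of_nat_eq_0_iff)
    obtain m n where mn: "i + 6 * k = 7 * m" "j + 6 * k = 7 * n"
      using dvd by (elim dvdE)
    have "m = n"
      using mn bounds by linarith
    then have "i = j"
      using mn by simp
    moreover have "i + j + k = 7 \<or> i + j + k = 14"
      using C(3) by (simp add: C_eq)
    ultimately have "2 * i + k = 7 \<or> 2 * i + k = 14"
      by (simp add: mult_2)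
    moreover have "i = 0 \<or> i = 1"
      using bounds by linarith
    ultimately consider "i = 0" "k = 7" | "i = 1" "k = 5" | "i = 1" "k = 12"
      using bounds by force
    then have "i = 0 \<and> k = 7"
      using dvd(1) by cases simp_all
    then show ?thesis
      using \<open>i = j\<close> by (simp add: C_eq)
  qed

  have "replicate_mset 7 g \<subseteq># Q\<^sub>0"
    using distinct by (auto simp: subseteq_mset_def Q\<^sub>0)
  moreover have "zero_sum (replicate_mset 7 g)"
    by (simp add: zero_sum_def vec_eq_iff F7_seven)
  ultimately have short: "{C. C \<subseteq># Q\<^sub>0 \<and> zero_sum C \<and> (size C = 7 \<or> size C = 14)} =
      {replicate_mset 7 g}"
    using uniq size_replicate_mset [of 7 g] by blast

  have "vec.dim (vec.span {g}) = 1"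
  proof -
    have "g \<noteq> 0"
      by (simp add: vec_eq_iff forall_2 g')
    then have "vec.independent {g}"
      by simp
    then show ?thesis
      by (simp add: vec.dim_eq_card_independent)
  qed
  then have "is_line (vec.span {g})"
    by (simp add: is_line_def)
  then have collinear: "collinear_mset (replicate_mset 7 g)"
    unfolding collinear_mset_def by (intro exI [of _ "vec.span {g}"]) (auto intro: vec.span_base)

  have "{xs. mset xs = replicate_mset 7 g} = {replicate 7 g}"
  proof (intro equalityI subsetI)
    fix xs assume "xs \<in> {xs. mset xs = replicate_mset 7 g}"
    then have xs: "mset xs = replicate_mset 7 g"
      by simp
    then have "length xs = 7" "set xs = {g}"
      by (metis size_mset size_replicate_mset) (use xs in \<open>simp flip: set_mset_mset\<close>)
    then show "xs \<in> {replicate 7 g}"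
      by (auto intro: replicate_eqI)
  qed simp
  then have single: "card (cross_sum_set (replicate_mset 7 g)) = 1"
    by (simp add: cross_sum_set_eq)

  have B_sub: "B \<subseteq># Q\<^sub>0"
    using distinct by (auto simp: subseteq_mset_def Q\<^sub>0 B_def)
  have B_zero: "zero_sum B"
  proof -
    have "(8 :: F7) = 7 + 1"
      by simp
    then have "(8 :: F7) = 1"
      by (simp only: F7_seven) simp
    then show ?thesis
      by (simp add: zero_sum_def vec_eq_iff forall_2 B_def e f g')
  qed
  have "vec.span {e, f} \<subseteq> vec.span (set_mset B)"
    by (intro vec.span_mono) (auto simp: B_def)
  then have B_span: "vec.span (set_mset B) = UNIV"
    using span by auto

  have B_cross: "cross_sum_set B = UNIV"
  proof -
    have "x \<in> cross_sum_set B" for x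
    proof -
      obtain b where b: "b < 7" "- x = of_nat b"
        \<comment> \<open>The ordering below has cross sum \<open>-b\<close>.\<close>
        using surj_of_nat_mod_ring [of "- x"] by auto
      define c where "c = 8 - b"
      have bc: "b + c = 8"
        using b by (simp add: c_def)
      let ?xs = "[e] @ replicate b g @ [f] @ replicate c g"
      \<comment> \<open>Cutting the word \<open>g\<^sup>8\<close> where \<open>f\<close> is inserted evaluates the two blocks together, without
        any formula for their separate cross sums.\<close>
      have "cross_sum (replicate b g @ replicate c g) = of_nat (8 choose 2)"
        by (simp flip: replicate_add add: bc cross_sum_replicate g')
      moreover have "7 dvd (8 choose 2 :: nat)"
        by (simp add: choose_two)
      ultimately have "cross_sum (replicate b g @ replicate c g) = 0"
        by (simp only: F7_of_nat_eq_0_iff)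
      then have gs: "cross_sum (replicate b g) + cross_sum (replicate c g) = - of_nat b * of_nat c"
        by (simp add: cross_sum_append sum_list_replicate g' eq_neg_iff_add_eq_0 algebra_simps)
      have "cross_sum ?xs = (cross_sum (replicate b g) + cross_sum (replicate c g))
          + of_nat b * of_nat c + 1 - of_nat (b + c) - of_nat b"
        unfolding cross_sum_append cross_sum_singleton
        by (simp add: sum_list_replicate e f g' algebra_simps)
      also have "\<dots> = - of_nat 7 - of_nat b"
        unfolding gs bc by simp
      also have "\<dots> = x"
        using b by (simp add: F7_seven flip: b(2))
      finally have "cross_sum ?xs = x" .
      moreover have "mset ?xs = B"
      proof -
        have "mset ?xs = {#e, f#} + replicate_mset (b + c) g"
          by (rule multiset_eqI) simp
        then show ?thesis
          by (simp only: bc B_def)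
      qed
      ultimately show ?thesis
        unfolding cross_sum_set_eq by blast
    qed
    then show ?thesis
      by blast
  qed

  have "zero_sum_family Q\<^sub>0 {#B#}"
    using B_sub B_zero by (simp add: zero_sum_family_def) (simp add: B_def)
  moreover have "(\<Sum>C \<in># {#B#}. card (cross_sum_set C) - 1) = 6"
    by (simp add: B_cross)
  ultimately have "6 \<in> {\<Sum>C \<in># F. card (cross_sum_set C) - 1 | F. zero_sum_family Q\<^sub>0 F}"
    by (metis (mono_tags, lifting) mem_Collect_eq)
  then have spread: "spread Q\<^sub>0 \<ge> 6"
    unfolding spread_def by (intro Max_ge spread_values_finite)

  have "size Q\<^sub>0 = 19" "size B = 10"
    by (simp_all add: Q\<^sub>0 B_def)
  then show ?thesis
    using lines short collinear single B_sub B_zero B_span B_cross spread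
    unfolding B_def by blast
qed

end
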